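(* For every integer $k\ge1$ there is a constant $c_k$ such that for all integers $n\ge1$, $r_o(S_k',P_n)\le n+c_k$.
   Context: An ordered graph is a graph with a linear ordering on its vertices; subgraphs inherit the ordering, and copies are taken via order-preserving isomorphisms. The ordered path $P_n$ has vertices $v_1<\dots<v_n$ and edges $v_iv_{i+1}$. The nested matching $N_k$ is the ordered graph with vertices $v_1<\dots<v_k<w_k<\dots<w_1$ and edges $v_1w_1,\dots,v_kw_k$. The partial St.~Ives matching $S_k'$ is the ordered matching obtained from $N_k$ by adding $k$ further vertex-disjoint copies of $N_k$, placed consecutively (each entirely to the left of the next), all of whose vertices lie strictly between $v_k$ and $w_k$. The online ordered Ramsey game for ordered graphs $G,H$ is played on vertex set $\mathbb N$ with its usual order: on each turn Builder draws a new edge between two vertices and Painter colors it red or blue; the game ends when there is a red copy of $G$ or a blue copy of $H$. Builder minimizes and Painter maximizes the number of turns; $r_o(G,H)$ is the number of turns under optimal play. *)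

theory Defs
  imports Main "HOL-Library.Extended_Nat"
begin

text \<open>
  An ordered graph is a pair of a vertex set in a linearly ordered type and a set of two-element
  edges; the vertex ordering is the one inherited from the type.
\<close>

type_synonym 'a ordered_graph = "'a set \<times> 'a set set"

text \<open>\<open>K\<close> has a (not necessarily induced) subgraph isomorphic to \<open>G\<close> by an order-preserving map.\<close>

definition contains_copy :: "'a::linorder ordered_graph \<Rightarrow> 'b::linorder ordered_graph \<Rightarrow> bool" where
  "contains_copy K G \<longleftrightarrow>
     (\<exists>f. strict_mono_on (fst G) f \<and> f ` fst G \<subseteq> fst K \<and> (\<forall>e\<in>snd G. f ` e \<in> snd K))"

definition relabel :: "('a \<Rightarrow> 'b) \<Rightarrow> 'a ordered_graph \<Rightarrow> 'b ordered_graph" where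
  "relabel f G = (f ` fst G, (\<lambda>e. f ` e) ` snd G)"

definition ordered_path :: "nat \<Rightarrow> nat ordered_graph" where
  "ordered_path n = ({..<n}, {{i, Suc i} | i. Suc i < n})"

text \<open>Numbering from 0, the vertex \<open>v\<close> with index \<open>i\<close> is \<open>i\<close> and its partner \<open>w\<close> is \<open>2 * k - 1 - i\<close>.\<close>

definition nested_matching :: "nat \<Rightarrow> nat ordered_graph" where
  "nested_matching k = ({..<2 * k}, {{i, 2 * k - 1 - i} | i. i < k})"

text \<open>
  The outer nested matching keeps its left endpoints at \<open>{..<k}\<close>, while its right endpoints are moved
  up by \<open>2 * k * k\<close> to make room for \<open>k\<close> consecutive blocks of \<open>2 * k\<close> vertices each.
\<close>

definition st_ives_outer :: "nat \<Rightarrow> nat ordered_graph" where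
  "st_ives_outer k = relabel (\<lambda>x. if x < k then x else x + 2 * k * k) (nested_matching k)"

definition st_ives_inner :: "nat \<Rightarrow> nat \<Rightarrow> nat ordered_graph" where
  "st_ives_inner k j = relabel (\<lambda>x. k + 2 * k * j + x) (nested_matching k)"

definition partial_st_ives :: "nat \<Rightarrow> nat ordered_graph" where
  "partial_st_ives k =
     (fst (st_ives_outer k) \<union> (\<Union>j<k. fst (st_ives_inner k j)),
      snd (st_ives_outer k) \<union> (\<Union>j<k. snd (st_ives_inner k j)))"

datatype colour = Red | Blue

text \<open>The list of coloured edges drawn so far, most recent first.\<close>

type_synonym history = "(nat set \<times> colour) list"

type_synonym builder = "history \<Rightarrow> nat set"

type_synonym painter = "history \<Rightarrow> nat set \<Rightarrow> colour"

text \<open>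
  Requiring a legal move after every history, reachable or not, loses no strategies: the board is
  infinite, so a new edge is always available.
\<close>

definition legal_builder :: "builder \<Rightarrow> bool" where
  "legal_builder \<sigma> \<longleftrightarrow> (\<forall>h. (\<exists>u v. u \<noteq> v \<and> \<sigma> h = {u, v}) \<and> \<sigma> h \<notin> fst ` set h)"

fun play :: "builder \<Rightarrow> painter \<Rightarrow> nat \<Rightarrow> history" where
  "play \<sigma> \<tau> 0 = []"
| "play \<sigma> \<tau> (Suc t) = (let h = play \<sigma> \<tau> t; e = \<sigma> h in (e, \<tau> h e) # h)"

definition colour_graph :: "colour \<Rightarrow> history \<Rightarrow> nat ordered_graph" where
  "colour_graph c h = (UNIV, {e. (e, c) \<in> set h})"

definition game_over :: "'a::linorder ordered_graph \<Rightarrow> 'b::linorder ordered_graph \<Rightarrow> history \<Rightarrow> bool" where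
  "game_over G H h \<longleftrightarrow>
     contains_copy (colour_graph Red h) G \<or> contains_copy (colour_graph Blue h) H"

text \<open>
  The number of turns until the game ends, \<open>\<infinity>\<close> if it never does. What \<^const>\<open>play\<close> does after
  the end of the game is irrelevant.
\<close>

definition duration ::
    "'a::linorder ordered_graph \<Rightarrow> 'b::linorder ordered_graph \<Rightarrow> builder \<Rightarrow> painter \<Rightarrow> enat" where
  "duration G H \<sigma> \<tau> = (INF t\<in>{t. game_over G H (play \<sigma> \<tau> t)}. enat t)"

definition online_ordered_ramsey ::
    "'a::linorder ordered_graph \<Rightarrow> 'b::linorder ordered_graph \<Rightarrow> enat" where
  "online_ordered_ramsey G H = (INF \<sigma>\<in>{\<sigma>. legal_builder \<sigma>}. SUP \<tau>. duration G H \<sigma> \<tau>)"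

end

theory Submission
  imports Defs Complex_Main "HOL-Library.Ramsey"
begin

text \<open>
  Builder plays on the dense order of the rationals, where every gap has room for further vertices,
  and always tries to extend one long blue path on the right. A blue answer costs nothing, so
  only the rounds started by a red answer have to be bounded in number, each having bounded cost.

  Suppose an edge \<open>pq\<close> from the path's end \<open>p\<close> is red. Builder drops \<open>p\<close>, prepares a short blue path
  inside \<open>(p, q)\<close> and tests all edges from the last \<open>k\<close> path vertices to the first \<open>k\<close> vertices of it.
  Either a blue edge lets the path continue nested below \<open>pq\<close>, or these edges form a red
  \<open>N\<^sub>k\<close> to the right of the path. Hence after at most \<open>k\<close> rounds there is a red \<open>N\<^sub>k\<close> that lies to the
  right of the path or has the path's end in its innermost gap.

  If the path's end is inside an outer \<open>N\<^sub>k\<close>, Builder forces further copies of \<open>N\<^sub>k\<close> there. If the end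
  is trapped in such a copy, Builder tests the edges from the last \<open>k\<close> path vertices to vertices
  just beyond it: the path escapes, or these edges form another copy to its right. Either way the copies
  inside the outer \<open>N\<^sub>k\<close> are disjoint, and \<open>k\<close> of them win. If the first \<open>N\<^sub>k\<close> lies to the right of the
  path, Builder collects \<open>k\<close> copies between the path and it and then tests the
  edges from the path's end into its innermost gap: refusing all of them would enclose the \<open>k\<close>
  copies, so the path gets inside.
\<close>

section \<open>The game\<close>

lemma contains_copy_mono:
  assumes "contains_copy (V, E) G" "E \<subseteq> E'"
  shows "contains_copy (V, E') G"
  using assms unfolding contains_copy_def by fastforce

text \<open>Positions rather than strategies: \<open>m\<close> bounds the turns still to come, so
  that forcing arguments become inductions and a strategy is extracted only at the end.\<close>

inductive wins :: "'a::linorder ordered_graph \<Rightarrow> 'b::linorder ordered_graph \<Rightarrow> nat \<Rightarrow> history \<Rightarrow> bool"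
  for G H where
  over: "game_over G H h \<Longrightarrow> wins G H m h"
| move: "u \<noteq> v \<Longrightarrow> {u, v} \<notin> fst ` set h \<Longrightarrow> (\<And>c. wins G H m (({u, v}, c) # h)) \<Longrightarrow> wins G H (Suc m) h"

lemma contains_copy_colour_graph_mono:
  assumes "contains_copy (colour_graph c h) G" "set h \<subseteq> set h'"
  shows "contains_copy (colour_graph c h') G"
  using assms unfolding colour_graph_def by (auto intro: contains_copy_mono)

lemma game_over_mono:
  assumes "game_over G H h" "set h \<subseteq> set h'"
  shows "game_over G H h'"
  using assms unfolding game_over_def by (blast intro: contains_copy_colour_graph_mono)

text \<open>Extra edges never hurt Builder. If the edge that the plan calls for is already drawn,
  its colour counts as Painter's answer and a turn is saved.\<close>

lemma wins_mono:
  assumes "wins G H m h" "m \<le> m'" "set h \<subseteq> set h'"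
  shows "wins G H m' h'"
  using assms
proof (induction arbitrary: m' h' rule: wins.induct)
  case (over h m)
  then show ?case by (meson game_over_mono wins.over)
next
  case (move u v h m)
  obtain m'' where m': "m' = Suc m''" "m \<le> m''" using move.prems(1) by (cases m') auto
  show ?case
  proof (cases "{u, v} \<in> fst ` set h'")
    case True
    then obtain c where "({u, v}, c) \<in> set h'" by force
    then show ?thesis using move.IH[of m' c h'] move.prems m' by auto
  next
    case False
    have "wins G H m'' (({u, v}, c) # h')" for c
      by (rule move.IH) (use move.prems m' in auto)
    then show ?thesis using wins.move[OF move.hyps(1) False] m' by blast
  qed
qed

lemma ex_new_edge: "\<exists>u v::nat. u \<noteq> v \<and> {u, v} \<notin> fst ` set (h :: history)"
proof -
  have "inj (\<lambda>i::nat. {0, Suc i})" by (auto simp: inj_def doubleton_eq_iff)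
  then have "infinite (range (\<lambda>i::nat. {0, Suc i}))" by (simp add: finite_image_iff)
  then obtain i where "{0, Suc i} \<notin> fst ` set h"
    by (meson List.finite_set finite_imageI finite_subset image_subsetI)
  then show ?thesis by (metis nat.distinct(1))
qed

text \<open>A strategy sees the history but not the remaining budget, so a single edge has to serve
  every budget. The edge chosen for the least winning budget does so by monotonicity.\<close>

lemma wins_move_uniform:
  "\<exists>e. (\<exists>u v. u \<noteq> v \<and> e = {u, v}) \<and> e \<notin> fst ` set h \<and>
     (\<forall>m. wins G H (Suc m) h \<longrightarrow> game_over G H h \<or> (\<forall>c. wins G H m ((e, c) # h)))"
proof (cases "(\<exists>m. wins G H m h) \<and> \<not> game_over G H h")
  case False
  then show ?thesis using ex_new_edge[of h] by blast
next
  case True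
  define m where "m = (LEAST m. wins G H m h)"
  have m: "wins G H m h" unfolding m_def using True LeastI_ex by metis
  then obtain u v m' where e: "m = Suc m'" "u \<noteq> v" "{u, v} \<notin> fst ` set h"
      "\<And>c. wins G H m' (({u, v}, c) # h)"
    using True by (auto elim: wins.cases)
  have "m \<le> Suc l" if "wins G H (Suc l) h" for l
    unfolding m_def using that by (rule Least_le)
  then have "wins G H l (({u, v}, c) # h)" if "wins G H (Suc l) h" for l c
    using that e(1) by (intro wins_mono[OF e(4)]) auto
  then show ?thesis using e by blast
qed

lemma online_ordered_ramsey_le:
  assumes "wins G H m []"
  shows "online_ordered_ramsey G H \<le> enat m"
proof -
  define good where "good h e \<longleftrightarrow> (\<exists>u v. u \<noteq> v \<and> e = {u, v}) \<and> e \<notin> fst ` set h \<and>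
     (\<forall>m. wins G H (Suc m) h \<longrightarrow> game_over G H h \<or> (\<forall>c. wins G H m ((e, c) # h)))"
    for h :: history and e :: "nat set"
  have "\<forall>h. \<exists>e. good h e" unfolding good_def using wins_move_uniform[of _ G H] by blast
  then obtain \<sigma> where \<sigma>: "\<And>h. good h (\<sigma> h)" by metis
  have legal: "legal_builder \<sigma>" using \<sigma> by (auto simp: legal_builder_def good_def)
  have "duration G H \<sigma> \<tau> \<le> enat m" for \<tau>
  proof -
    \<comment> \<open>\<open>play\<close> continues after the end of the game, so the invariant
      records an end at any earlier time.\<close>
    have inv: "(\<exists>s\<le>t. game_over G H (play \<sigma> \<tau> s)) \<or> wins G H (m - t) (play \<sigma> \<tau> t)" if "t \<le> m" for t
      using that
    proof (induction t)
      case 0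
      then show ?case using assms by simp
    next
      case (Suc t)
      show ?case
      proof (cases "\<exists>s\<le>t. game_over G H (play \<sigma> \<tau> s)")
        case True
        then show ?thesis using le_Suc_eq by blast
      next
        case False
        then have "wins G H (Suc (m - Suc t)) (play \<sigma> \<tau> t)"
          using Suc by (metis Suc_diff_Suc Suc_leD Suc_le_lessD)
        then show ?thesis using \<sigma>[of "play \<sigma> \<tau> t"] False by (auto simp: good_def Let_def)
      qed
    qed
    \<comment> \<open>After \<open>m\<close> turns the budget is 0, where only the rule
      \<open>over\<close> applies.\<close>
    have "\<exists>s\<le>m. game_over G H (play \<sigma> \<tau> s)"
      using inv[of m] by (auto elim: wins.cases)
    then show ?thesis unfolding duration_def by (meson INF_lower2 enat_ord_simps(1) mem_Collect_eq)
  qed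
  then have "(SUP \<tau>. duration G H \<sigma> \<tau>) \<le> enat m" by (simp add: SUP_least)
  then show ?thesis unfolding online_ordered_ramsey_def using legal
    by (meson INF_lower2 mem_Collect_eq)
qed

text \<open>On this board an edge may be asked again. That is harmless: on transfer to
  \<open>wins\<close>, the branch of the colour already present is followed.\<close>

inductive forces ::
    "'a::linorder ordered_graph \<Rightarrow> 'b::linorder ordered_graph \<Rightarrow> nat \<Rightarrow> rat set set \<Rightarrow> rat set set \<Rightarrow> bool"
  for G H where
  red: "contains_copy (UNIV, R) G \<Longrightarrow> forces G H m R B"
| blue: "contains_copy (UNIV, B) H \<Longrightarrow> forces G H m R B"
| step: "u \<noteq> v \<Longrightarrow> forces G H m (insert {u, v} R) B \<Longrightarrow> forces G H m R (insert {u, v} B) \<Longrightarrow>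
    forces G H (Suc m) R B"

lemma forces_mono:
  assumes "forces G H m R B" "m \<le> m'" "R \<subseteq> R'" "B \<subseteq> B'"
  shows "forces G H m' R' B'"
  using assms
proof (induction arbitrary: m' R' B' rule: forces.induct)
  case (red R m B)
  then show ?case by (meson contains_copy_mono forces.red)
next
  case (blue B m R)
  then show ?case by (meson contains_copy_mono forces.blue)
next
  case (step u v m R B)
  obtain m'' where m': "m' = Suc m''" "m \<le> m''" using step.prems(1) by (cases m') auto
  show ?case unfolding m'(1)
  proof (rule forces.step[OF step.hyps(1)])
    show "forces G H m'' (insert {u, v} R') B'" by (rule step.IH(1)) (use m' step.prems in auto)
    show "forces G H m'' R' (insert {u, v} B')" by (rule step.IH(2)) (use m' step.prems in auto)
  qed
qed

text \<open>A copy occupies finitely many vertices, so a map need only be monotone on these to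
  preserve it.\<close>

lemma contains_copy_transfer:
  assumes "contains_copy (UNIV, E) G" "finite (fst G)" "\<And>e. e \<in> snd G \<Longrightarrow> e \<subseteq> fst G"
  obtains S :: "rat set" where "finite S"
    "\<And>(f :: rat \<Rightarrow> nat) F. strict_mono_on S f \<Longrightarrow> (\<And>e. e \<in> E \<Longrightarrow> e \<subseteq> S \<Longrightarrow> f ` e \<in> F) \<Longrightarrow>
       contains_copy (UNIV, F) G"
proof -
  from assms(1) obtain g where g: "strict_mono_on (fst G) g" "\<And>e. e \<in> snd G \<Longrightarrow> g ` e \<in> E"
    unfolding contains_copy_def by auto
  show ?thesis
  proof (rule that[of "g ` fst G"])
    show "finite (g ` fst G)" using assms(2) by simp
    fix f :: "rat \<Rightarrow> nat" and F
    assume f: "strict_mono_on (g ` fst G) f" "\<And>e. e \<in> E \<Longrightarrow> e \<subseteq> g ` fst G \<Longrightarrow> f ` e \<in> F"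
    have "strict_mono_on (fst G) (f \<circ> g)" using f(1) g(1) by (auto simp: strict_mono_on_def)
    moreover have "(f \<circ> g) ` e \<in> F" if "e \<in> snd G" for e
      using f(2)[OF g(2)[OF that]] assms(3)[OF that] by (auto simp: image_comp image_mono)
    ultimately show "contains_copy (UNIV, F) G" unfolding contains_copy_def by auto
  qed
qed

text \<open>Only finitely many positions can occur within \<open>m\<close> turns, so the dense board embeds into \<open>\<nat>\<close>.\<close>

lemma forces_transfer:
  assumes "forces G H m R B"
    and "finite (fst G)" "\<And>e. e \<in> snd G \<Longrightarrow> e \<subseteq> fst G"
    and "finite (fst H)" "\<And>e. e \<in> snd H \<Longrightarrow> e \<subseteq> fst H"
  shows "\<exists>S. finite S \<and> (\<forall>(f :: rat \<Rightarrow> nat) h. strict_mono_on S f \<longrightarrow>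
      (\<forall>e\<in>R. e \<subseteq> S \<longrightarrow> (f ` e, Red) \<in> set h) \<longrightarrow> (\<forall>e\<in>B. e \<subseteq> S \<longrightarrow> (f ` e, Blue) \<in> set h) \<longrightarrow>
      wins G H m h)"
  using assms(1)
proof induction
  case (red R m B)
  from contains_copy_transfer[OF this assms(2,3)] obtain S where S: "finite S"
    "\<And>(f :: rat \<Rightarrow> nat) F. strict_mono_on S f \<Longrightarrow> (\<And>e. e \<in> R \<Longrightarrow> e \<subseteq> S \<Longrightarrow> f ` e \<in> F) \<Longrightarrow>
       contains_copy (UNIV, F) G" by metis
  show ?case
    by (rule exI[of _ S]) (auto intro!: S wins.over simp: game_over_def colour_graph_def)
next
  case (blue B m R)
  from contains_copy_transfer[OF this assms(4,5)] obtain S where S: "finite S"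
    "\<And>(f :: rat \<Rightarrow> nat) F. strict_mono_on S f \<Longrightarrow> (\<And>e. e \<in> B \<Longrightarrow> e \<subseteq> S \<Longrightarrow> f ` e \<in> F) \<Longrightarrow>
       contains_copy (UNIV, F) H" by metis
  have "contains_copy (colour_graph Blue h) H"
    if "strict_mono_on S f" "\<forall>e\<in>B. e \<subseteq> S \<longrightarrow> (f ` e, Blue) \<in> set h" for f :: "rat \<Rightarrow> nat" and h
    unfolding colour_graph_def using that by (intro S(2)[of f]) auto
  then show ?case using S(1) by (auto intro!: exI[of _ S] wins.over simp: game_over_def)
next
  case (step u v m R B)
  from step.IH(1) obtain S1 where "finite S1" and
    S1: "\<And>(f :: rat \<Rightarrow> nat) h. strict_mono_on S1 f \<Longrightarrow>
      (\<forall>e\<in>insert {u, v} R. e \<subseteq> S1 \<longrightarrow> (f ` e, Red) \<in> set h) \<Longrightarrow>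
      (\<forall>e\<in>B. e \<subseteq> S1 \<longrightarrow> (f ` e, Blue) \<in> set h) \<Longrightarrow> wins G H m h"
    by blast
  from step.IH(2) obtain S2 where "finite S2" and
    S2: "\<And>(f :: rat \<Rightarrow> nat) h. strict_mono_on S2 f \<Longrightarrow>
      (\<forall>e\<in>R. e \<subseteq> S2 \<longrightarrow> (f ` e, Red) \<in> set h) \<Longrightarrow>
      (\<forall>e\<in>insert {u, v} B. e \<subseteq> S2 \<longrightarrow> (f ` e, Blue) \<in> set h) \<Longrightarrow> wins G H m h"
    by blast
  define S where "S = insert u (insert v (S1 \<union> S2))"
  have "wins G H (Suc m) h" if f: "strict_mono_on S f"
      and R: "\<forall>e\<in>R. e \<subseteq> S \<longrightarrow> (f ` e, Red) \<in> set h"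
      and B: "\<forall>e\<in>B. e \<subseteq> S \<longrightarrow> (f ` e, Blue) \<in> set h" for f :: "rat \<Rightarrow> nat" and h
  proof -
    have f12: "strict_mono_on S1 f" "strict_mono_on S2 f"
      using f unfolding S_def by (auto simp: strict_mono_on_def)
    have uv: "f u \<noteq> f v"
      using f step.hyps(1) strict_mono_on_imp_inj_on[OF f] by (auto simp: S_def inj_on_def)
    have "wins G H m (({f u, f v}, c) # h)" for c
    proof (cases c)
      case Red
      show ?thesis by (rule S1[OF f12(1)]) (use R B Red in \<open>auto simp: S_def subset_insertI2\<close>)
    next
      case Blue
      show ?thesis by (rule S2[OF f12(2)]) (use R B Blue in \<open>auto simp: S_def subset_insertI2\<close>)
    qed
    then have *: "wins G H m (({f u, f v}, c) # h)" for c .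
    show ?thesis
    proof (cases "{f u, f v} \<in> fst ` set h")
      case False
      then show ?thesis using wins.move[OF uv] * by blast
    next
      case True
      then obtain c where "({f u, f v}, c) \<in> set h" by force
      then show ?thesis by (intro wins_mono[OF *[of c]]) auto
    qed
  qed
  then show ?case using \<open>finite S1\<close> \<open>finite S2\<close> by (intro exI[of _ S]) (auto simp: S_def)
qed

lemma ex_strict_mono_on_nat:
  fixes S :: "'a::linorder set"
  assumes "finite S"
  shows "\<exists>f :: 'a \<Rightarrow> nat. strict_mono_on S f"
proof -
  have "card {y \<in> S. y < a} < card {y \<in> S. y < b}" if "a \<in> S" "a < b" for a b
    by (rule psubset_card_mono) (use assms that in auto)
  then show ?thesis by (intro exI[of _ "\<lambda>x. card {y \<in> S. y < x}"]) (auto simp: strict_mono_on_def)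
qed

lemma online_ordered_ramsey_le_forces:
  assumes "forces G H m {} {}"
    and "finite (fst G)" "\<And>e. e \<in> snd G \<Longrightarrow> e \<subseteq> fst G"
    and "finite (fst H)" "\<And>e. e \<in> snd H \<Longrightarrow> e \<subseteq> fst H"
  shows "online_ordered_ramsey G H \<le> enat m"
proof -
  from forces_transfer[OF assms] obtain S where "finite S" and
    S: "\<And>f :: rat \<Rightarrow> nat. strict_mono_on S f \<Longrightarrow> wins G H m []" by fastforce
  then have "wins G H m []" using ex_strict_mono_on_nat by blast
  then show ?thesis by (rule online_ordered_ramsey_le)
qed

text \<open>Non-adaptive questions: all of \<open>Q\<close> is asked whatever the answers, and the
  continuation must handle every possible red part \<open>X\<close>.\<close>

lemma forces_query:
  assumes "finite Q" "\<And>e. e \<in> Q \<Longrightarrow> \<exists>u v. u \<noteq> v \<and> e = {u, v}"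
    and "\<And>X. X \<subseteq> Q \<Longrightarrow> forces G H m (R \<union> X) (B \<union> (Q - X))"
  shows "forces G H (m + card Q) R B"
  using assms
proof (induction Q arbitrary: R B rule: finite_induct)
  case empty
  then show ?case using empty(2)[of "{}"] by simp
next
  case (insert e Q)
  obtain u v where e: "u \<noteq> v" "e = {u, v}" using insert.prems(1) by blast
  have "forces G H (m + card Q) (insert {u, v} R) B"
  proof (rule insert.IH)
    fix X assume "X \<subseteq> Q"
    then show "forces G H m (insert {u, v} R \<union> X) (B \<union> (Q - X))"
      using insert.prems(2)[of "insert e X"] insert.hyps(2) e(2)
      by (simp add: Diff_insert0 insert_mono subset_insertI2)
  qed (use insert.prems(1) in auto)
  moreover have "forces G H (m + card Q) R (insert {u, v} B)"
  proof (rule insert.IH)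
    fix X assume X: "X \<subseteq> Q"
    then have "insert e Q - X = insert e (Q - X)" using insert.hyps(2) by auto
    then show "forces G H m (R \<union> X) (insert {u, v} B \<union> (Q - X))"
      using insert.prems(2)[of X] X e(2) by auto
  qed (use insert.prems(1) in auto)
  ultimately show ?case using forces.step[OF e(1)] insert.hyps by simp
qed

section \<open>Copies of the matching and of the path\<close>

definition nested_edges :: "rat set set \<Rightarrow> nat \<Rightarrow> rat \<Rightarrow> rat \<Rightarrow> rat \<Rightarrow> rat \<Rightarrow>
    (nat \<Rightarrow> rat) \<Rightarrow> (nat \<Rightarrow> rat) \<Rightarrow> bool" where
  "nested_edges R k a b x y l r \<longleftrightarrow>
     (\<forall>i<k. a < l i \<and> l i \<le> x \<and> y \<le> r i \<and> r i < b \<and> {l i, r i} \<in> R) \<and>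
     (\<forall>i j. i < j \<longrightarrow> j < k \<longrightarrow> l i < l j \<and> r j < r i)"

text \<open>\<open>(a, b)\<close> is the room holding the matching and \<open>(x, y)\<close> a gap
  in its centre. The order of the four numbers is demanded separately, so that \<open>k = 0\<close>
  gives a plain gap from which nesting can start.\<close>

definition nest :: "rat set set \<Rightarrow> nat \<Rightarrow> rat \<Rightarrow> rat \<Rightarrow> rat \<Rightarrow> rat \<Rightarrow> bool" where
  "nest R k a b x y \<longleftrightarrow> a \<le> x \<and> x < y \<and> y \<le> b \<and> (\<exists>l r. nested_edges R k a b x y l r)"

lemma nestI:
  assumes "a \<le> x" "x < y" "y \<le> b"
    and "\<And>i. i < k \<Longrightarrow> a < l i \<and> l i \<le> x \<and> y \<le> r i \<and> r i < b \<and> {l i, r i} \<in> R"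
    and "\<And>i j. i < j \<Longrightarrow> j < k \<Longrightarrow> l i < l j \<and> r j < r i"
  shows "nest R k a b x y"
  unfolding nest_def nested_edges_def using assms by (intro conjI exI[of _ l] exI[of _ r]) auto

lemma nested_edgesD:
  assumes "nested_edges R k a b x y l r"
  shows "\<And>i. i < k \<Longrightarrow> a < l i \<and> l i \<le> x \<and> y \<le> r i \<and> r i < b \<and> {l i, r i} \<in> R"
    and "\<And>i j. i < j \<Longrightarrow> j < k \<Longrightarrow> l i < l j \<and> r j < r i"
  using assms unfolding nested_edges_def by blast+

lemma nest_0: "nest R 0 a b x y \<longleftrightarrow> a \<le> x \<and> x < y \<and> y \<le> b"
  by (simp add: nest_def nested_edges_def)

lemma nest_less: "nest R k a b x y \<Longrightarrow> x < y"
  by (simp add: nest_def)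

lemma nest_mono:
  assumes "nest R k a b x y" "R \<subseteq> R'" "a' \<le> a" "b \<le> b'"
  shows "nest R' k a' b' x y"
proof -
  from assms(1) obtain l r where "nested_edges R k a b x y l r" and ab: "a \<le> x" "x < y" "y \<le> b"
    unfolding nest_def by blast
  note * = nested_edgesD[OF this(1)]
  show ?thesis
  proof (rule nestI)
    show "a' < l i \<and> l i \<le> x \<and> y \<le> r i \<and> r i < b' \<and> {l i, r i} \<in> R'" if "i < k" for i
      using *(1)[OF that] assms(2-4) by auto
  qed (use * ab assms in auto)
qed

lemma nest_Suc:
  assumes "nest R k a b x y" "x < p" "p < q" "q < y" "{p, q} \<in> R"
  shows "nest R (Suc k) a b p q"
proof -
  from assms(1) obtain l r where "nested_edges R k a b x y l r" and ab: "a \<le> x" "x < y" "y \<le> b"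
    unfolding nest_def by blast
  note * = nested_edgesD[OF this(1)]
  let ?l = "l(k := p)" and ?r = "r(k := q)"
  have 1: "a < ?l i \<and> ?l i \<le> p \<and> q \<le> ?r i \<and> ?r i < b \<and> {?l i, ?r i} \<in> R" if "i < Suc k" for i
  proof (cases "i = k")
    case False
    then show ?thesis using *(1)[of i] that assms(2-4) by auto
  qed (use assms ab in auto)
  have 2: "?l i < ?l j \<and> ?r j < ?r i" if "i < j" "j < Suc k" for i j
  proof (cases "j = k")
    case True
    then show ?thesis using *(1)[of i] that assms(2-4) by auto
  qed (use *(2) that in auto)
  show ?thesis by (rule nestI[of _ _ _ _ _ ?l ?r]) (use 1 2 assms ab in auto)
qed

text \<open>The outermost right endpoint lies strictly below \<open>b\<close>. This leaves free room
  \<open>(c, b)\<close> into which a path trapped in the matching can later jump.\<close>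

lemma nest_shrink:
  assumes "nest R k a b x y" "k \<ge> 1"
  obtains c where "c < b" "nest R k a c x y"
proof -
  from assms(1) obtain l r where "nested_edges R k a b x y l r" and ab: "a \<le> x" "x < y" "y \<le> b"
    unfolding nest_def by blast
  note * = nested_edgesD[OF this(1)]
  obtain c where c: "r 0 < c" "c < b" using *(1)[of 0] assms(2) dense by auto
  have r: "r i < c" if "i < k" for i using *(2)[of 0 i] that c(1) by (cases "i = 0") auto
  have "nest R k a c x y"
  proof (rule nestI[of _ _ _ _ _ l r])
    show "y \<le> c" using *(1)[of 0] assms(2) c(1) by auto
  qed (use *(1) r *(2) ab in auto)
  then show ?thesis using c that by blast
qed

text \<open>The smallest left vertex is paired with the largest right one, and so on inwards. Both
  lists are decreasing, hence the reversed index on \<open>ps\<close>.\<close>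

lemma nest_complete_bipartite:
  assumes "length ps = k" "length qs = k" "k \<ge> 1"
    and ps: "sorted_wrt (>) ps" "\<And>p. p \<in> set ps \<Longrightarrow> a < p"
    and qs: "sorted_wrt (>) qs" "\<And>q. q \<in> set qs \<Longrightarrow> q < b"
    and lt: "hd ps < last qs"
    and red: "\<And>p q. p \<in> set ps \<Longrightarrow> q \<in> set qs \<Longrightarrow> {p, q} \<in> R"
  shows "nest R k a b (hd ps) (last qs)"
proof -
  let ?l = "\<lambda>i. ps ! (k - 1 - i)" and ?r = "\<lambda>i. qs ! i"
  have hd: "hd ps = ps ! 0" "last qs = qs ! (k - 1)" "ps \<noteq> []" "qs \<noteq> []"
    using assms(1-3) by (auto simp: hd_conv_nth last_conv_nth simp flip: length_greater_0_conv)
  have le: "ps ! i \<le> ps ! 0" "qs ! (k - 1) \<le> qs ! i" if "i < k" for i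
  proof -
    show "ps ! i \<le> ps ! 0"
      using sorted_wrt_nth_less[OF ps(1), of 0 i] that assms(1) by (cases "i = 0") auto
    show "qs ! (k - 1) \<le> qs ! i"
      using sorted_wrt_nth_less[OF qs(1), of i "k - 1"] that assms(2) by (cases "i < k - 1") (auto simp: not_less_iff_gr_or_eq)
  qed
  have 1: "a < ?l i \<and> ?l i \<le> hd ps \<and> last qs \<le> ?r i \<and> ?r i < b \<and> {?l i, ?r i} \<in> R" if "i < k" for i
    using le[of "k - 1 - i"] le[of i] that assms(1-3) hd ps(2) qs(2) red by auto
  have 2: "?l i < ?l j \<and> ?r j < ?r i" if "i < j" "j < k" for i j
    using sorted_wrt_nth_less[OF ps(1), of "k - 1 - j" "k - 1 - i"]
      sorted_wrt_nth_less[OF qs(1), of i j] that assms(1,2) by auto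
  have "a < hd ps" "last qs < b" using ps(2) qs(2) hd(3,4) by auto
  then show ?thesis by (intro nestI[of _ _ _ _ _ ?l ?r]) (use 1 2 lt in auto)
qed

definition matching_copy :: "rat set set \<Rightarrow> nat \<Rightarrow> (nat \<Rightarrow> rat) \<Rightarrow> rat \<Rightarrow> rat \<Rightarrow> bool" where
  "matching_copy R k g a b \<longleftrightarrow> strict_mono_on {..<2 * k} g \<and> (\<forall>i<2 * k. a < g i \<and> g i < b) \<and>
     (\<forall>i<k. {g i, g (2 * k - 1 - i)} \<in> R)"

lemma nest_embedding:
  assumes "nest R k a b x y"
  obtains g where "matching_copy R k g a b"
    "\<forall>i<k. g i \<le> x" "\<forall>i. k \<le> i \<longrightarrow> i < 2 * k \<longrightarrow> y \<le> g i"
proof -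
  from assms(1) obtain l r where "nested_edges R k a b x y l r" and ab: "a \<le> x" "x < y" "y \<le> b"
    unfolding nest_def by blast
  note * = nested_edgesD[OF this(1)]
  \<comment> \<open>\<open>nested_edges\<close> indexes both sides from the outside inwards, whereas
    \<open>nested_matching\<close> counts from left to right.\<close>
  define g where "g i = (if i < k then l i else r (2 * k - 1 - i))" for i
  have "g i < g j" if "i < j" "j < 2 * k" for i j
  proof -
    consider "j < k" | "i < k" "k \<le> j" | "k \<le> i" using that by linarith
    then show ?thesis
    proof cases
      case 2
      then have "2 * k - 1 - j < k" using that by arith
      then show ?thesis using *(1)[of i] *(1)[of "2 * k - 1 - j"] 2 ab by (auto simp: g_def)
    next
      case 3
      then have "2 * k - 1 - j < 2 * k - 1 - i" "2 * k - 1 - i < k" using that by arith+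
      then show ?thesis using *(2) 3 that by (auto simp: g_def)
    qed (use * that in \<open>auto simp: g_def\<close>)
  qed
  then have "strict_mono_on {..<2 * k} g" by (auto simp: strict_mono_on_def)
  moreover have "a < g i \<and> g i < b" if "i < 2 * k" for i
  proof (cases "i < k")
    case False
    then have "2 * k - 1 - i < k" using that by arith
    then show ?thesis using *(1)[of "2 * k - 1 - i"] ab False by (auto simp: g_def)
  qed (use *(1)[of i] ab in \<open>auto simp: g_def\<close>)
  moreover have "g i \<le> x" if "i < k" for i using * that by (simp add: g_def)
  moreover have "y \<le> g i" if "k \<le> i" "i < 2 * k" for i
  proof -
    have "2 * k - 1 - i < k" using that by arith
    then show ?thesis using *(1)[of "2 * k - 1 - i"] that by (simp add: g_def)
  qed
  moreover have "{g i, g (2 * k - 1 - i)} \<in> R" if "i < k" for i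
    using *(1)[of i] that by (auto simp: g_def)
  ultimately show ?thesis using that unfolding matching_copy_def by blast
qed

text \<open>The cut points \<open>c\<close> keep successive copies disjoint and in order, and let
  chains be concatenated.\<close>

primrec chain :: "rat set set \<Rightarrow> nat \<Rightarrow> nat \<Rightarrow> rat \<Rightarrow> rat \<Rightarrow> bool" where
  "chain R k 0 a b \<longleftrightarrow> a \<le> b"
| "chain R k (Suc j) a b \<longleftrightarrow> (\<exists>c x y. nest R k a c x y \<and> chain R k j c b)"

lemma chain_mono:
  "chain R k j a b \<Longrightarrow> R \<subseteq> R' \<Longrightarrow> a' \<le> a \<Longrightarrow> b \<le> b' \<Longrightarrow> chain R' k j a' b'"
proof (induction j arbitrary: a a')
  case (Suc j)
  then obtain c x y where "nest R k a c x y" "chain R k j c b" by auto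
  then show ?case using Suc.IH[of c c] Suc.prems nest_mono[of R k a c x y R' a' c] by auto
qed auto

lemma chain_append: "chain R k i a b \<Longrightarrow> chain R k j b c \<Longrightarrow> chain R k (i + j) a c"
proof (induction i arbitrary: a)
  case 0
  then show ?case using chain_mono[of R k j b c R a c] by auto
next
  case (Suc i)
  then show ?case by auto
qed

lemma chain_less_eq: "chain R k j a b \<Longrightarrow> a \<le> b"
proof (induction j arbitrary: a)
  case (Suc j)
  then obtain c x y where c: "nest R k a c x y" "chain R k j c b" by auto
  then have "a < c" by (auto simp: nest_def)
  then show ?case using Suc.IH[OF c(2)] by simp
qed auto

text \<open>A chain may be longer than required, so its first \<open>i\<close> copies are
  extracted.\<close>

lemma chain_embedding:
  assumes "chain R k j a b" "i \<le> j"
  shows "\<exists>h. (\<forall>t<i. matching_copy R k (h t) a b) \<and>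
    (\<forall>s t z w. s < t \<longrightarrow> t < i \<longrightarrow> z < 2 * k \<longrightarrow> w < 2 * k \<longrightarrow> h s z < h t w)"
  using assms
proof (induction i arbitrary: j a)
  case (Suc i)
  from Suc.prems obtain j' where j': "j = Suc j'" "i \<le> j'" by (cases j) auto
  then obtain c x y where c: "nest R k a c x y" "chain R k j' c b" using Suc.prems by auto
  from Suc.IH[OF c(2) j'(2)] obtain h where h: "\<forall>t<i. matching_copy R k (h t) c b"
    "\<forall>s t z w. s < t \<longrightarrow> t < i \<longrightarrow> z < 2 * k \<longrightarrow> w < 2 * k \<longrightarrow> h s z < h t w" by (elim exE conjE)
  from nest_embedding[OF c(1)] obtain g where g: "matching_copy R k g a c" by metis
  have ac: "a < c" using c(1) by (auto simp: nest_def)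
  have cb: "c \<le> b" using chain_less_eq[OF c(2)] .
  let ?h = "case_nat g h"
  have "matching_copy R k (?h t) a b" if "t < Suc i" for t
    using g h(1) that ac cb
    by (fastforce simp: matching_copy_def split: nat.splits)
  moreover have "?h s z < ?h t w" if "s < t" "t < Suc i" "z < 2 * k" "w < 2 * k" for s t z w
  proof -
    obtain t' where t: "t = Suc t'" "t' < i" using \<open>s < t\<close> \<open>t < Suc i\<close> by (cases t) auto
    show ?thesis
    proof (cases s)
      case 0
      have "g z < c" "c < h t' w" using g h(1) t that unfolding matching_copy_def by auto
      then show ?thesis using 0 t by simp
    next
      case (Suc s')
      then show ?thesis using h(2) that t by auto
    qed
  qed
  ultimately show ?case by (intro exI[of _ ?h]) blast
qed auto

section \<open>Vertices, edges and copies of the partial St. Ives matching\<close>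

lemma finite_vertices_st_ives: "finite (fst (partial_st_ives k))"
  by (auto simp: partial_st_ives_def st_ives_outer_def st_ives_inner_def relabel_def nested_matching_def)

lemma edges_relabel_subset:
  assumes "\<And>e. e \<in> snd G \<Longrightarrow> e \<subseteq> fst G" "e \<in> snd (relabel f G)"
  shows "e \<subseteq> fst (relabel f G)"
proof -
  obtain e' where "e' \<in> snd G" "e = f ` e'" using assms(2) by (auto simp: relabel_def)
  then show ?thesis using assms(1) by (simp add: relabel_def image_mono)
qed

lemma edges_st_ives_subset:
  assumes "e \<in> snd (partial_st_ives k)"
  shows "e \<subseteq> fst (partial_st_ives k)"
proof -
  have N: "e \<subseteq> fst (nested_matching k)" if "e \<in> snd (nested_matching k)" for e
    using that by (auto simp: nested_matching_def)
  consider "e \<in> snd (st_ives_outer k)" | j where "j < k" "e \<in> snd (st_ives_inner k j)"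
    using assms by (auto simp: partial_st_ives_def)
  then show ?thesis
  proof cases
    case 1
    then have "e \<subseteq> fst (st_ives_outer k)" unfolding st_ives_outer_def by (intro edges_relabel_subset[OF N])
    then show ?thesis by (auto simp: partial_st_ives_def)
  next
    case 2
    then have "e \<subseteq> fst (st_ives_inner k j)"
      unfolding st_ives_inner_def by (intro edges_relabel_subset[OF N])
    then show ?thesis using 2(1) by (auto simp: partial_st_ives_def)
  qed
qed

lemma vertices_st_ives: "fst (partial_st_ives k) \<subseteq> {..<2 * k + 2 * k * k}"
proof -
  have "k + 2 * k * j + x < 2 * k + 2 * k * k" if "j < k" "x < 2 * k" for j x
  proof -
    have "2 * k * j + 2 * k \<le> 2 * k * k" using mult_le_mono2[of "Suc j" k "2 * k"] that(1) by simp
    then show ?thesis using that by linarith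
  qed
  then show ?thesis
    by (auto simp: partial_st_ives_def st_ives_outer_def st_ives_inner_def relabel_def nested_matching_def)
qed

lemma st_ives_edge_cases:
  assumes "e \<in> snd (partial_st_ives k)"
  obtains i where "i < k" "e = {i, 2 * k * k + (2 * k - 1 - i)}"
  | j i where "j < k" "i < k" "e = {k + 2 * k * j + i, k + 2 * k * j + (2 * k - 1 - i)}"
proof -
  from assms consider "e \<in> snd (st_ives_outer k)" | j where "j < k" "e \<in> snd (st_ives_inner k j)"
    unfolding partial_st_ives_def by auto
  then show ?thesis
  proof cases
    case 1
    then obtain i where i: "i < k" "e = (\<lambda>x. if x < k then x else x + 2 * k * k) ` {i, 2 * k - 1 - i}"
      unfolding st_ives_outer_def relabel_def nested_matching_def by auto
    then have "\<not> 2 * k - 1 - i < k" by arith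
    then have "e = {i, 2 * k * k + (2 * k - 1 - i)}" using i by (simp add: add.commute insert_commute)
    then show ?thesis using that(1) i(1) by blast
  next
    case 2
    then obtain i where i: "i < k" "e = (\<lambda>x. k + 2 * k * j + x) ` {i, 2 * k - 1 - i}"
      unfolding st_ives_inner_def relabel_def nested_matching_def by auto
    then show ?thesis using that(2)[OF 2(1) i(1)] by simp
  qed
qed

lemma st_ives_copy:
  assumes "nest R k a b x y" "chain R k j c d" "x \<le> c" "d \<le> y" "k \<le> j"
  shows "contains_copy (UNIV, R) (partial_st_ives k)"
proof -
  from nest_embedding[OF assms(1)] obtain g where "matching_copy R k g a b" and
    "\<forall>i<k. g i \<le> x" "\<forall>i. k \<le> i \<longrightarrow> i < 2 * k \<longrightarrow> y \<le> g i" by metis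
  then have g: "strict_mono_on {..<2 * k} g"
    "\<And>i. i < k \<Longrightarrow> g i \<le> x" "\<And>i. k \<le> i \<Longrightarrow> i < 2 * k \<Longrightarrow> y \<le> g i"
    "\<And>i. i < k \<Longrightarrow> {g i, g (2 * k - 1 - i)} \<in> R" by (auto simp: matching_copy_def)
  from chain_embedding[OF assms(2,5)] obtain h where "\<forall>t<k. matching_copy R k (h t) c d"
    and h': "\<forall>s t z w. s < t \<longrightarrow> t < k \<longrightarrow> z < 2 * k \<longrightarrow> w < 2 * k \<longrightarrow> h s z < h t w" by (elim exE conjE)
  then have h: "\<And>t. t < k \<Longrightarrow> strict_mono_on {..<2 * k} (h t)"
    "\<And>t z. t < k \<Longrightarrow> z < 2 * k \<Longrightarrow> c < h t z \<and> h t z < d"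
    "\<And>t z. t < k \<Longrightarrow> z < k \<Longrightarrow> {h t z, h t (2 * k - 1 - z)} \<in> R"
    "\<And>s t z w. s < t \<Longrightarrow> t < k \<Longrightarrow> z < 2 * k \<Longrightarrow> w < 2 * k \<Longrightarrow> h s z < h t w"
    by (auto simp: matching_copy_def)
  \<comment> \<open>Three ranges: outer left endpoints, then \<open>k\<close> blocks of
    \<open>2 * k\<close> vertices, where the quotient selects the copy and the remainder its vertex,
    then outer right endpoints.\<close>
  define f where "f v = (if v < k then g v else if v < k + 2 * k * k
      then h ((v - k) div (2 * k)) ((v - k) mod (2 * k)) else g (v - 2 * k * k))" for v
  have xy: "x < y" using assms(1) by (rule nest_less)
  have dm: "(v - k) div (2 * k) < k" "(v - k) mod (2 * k) < 2 * k"
    if "k \<le> v" "v < k + 2 * k * k" for v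
  proof -
    have "v - k < k * (2 * k)" "0 < k" using that by (auto simp: algebra_simps intro: gr0I)
    then show "(v - k) div (2 * k) < k" "(v - k) mod (2 * k) < 2 * k"
      by (auto simp: less_mult_imp_div_less)
  qed
  have mid: "x < f v" "f v < y" if "k \<le> v" "v < k + 2 * k * k" for v
    using h(2)[OF dm[OF that]] assms(3,4) that by (auto simp: f_def)
  have "f v < f w" if vw: "v < w" "w < 2 * k + 2 * k * k" for v w
  proof -
    consider "w < k" | "v < k" "k \<le> w" "w < k + 2 * k * k" | "v < k" "k + 2 * k * k \<le> w"
      | "k \<le> v" "w < k + 2 * k * k" | "k \<le> v" "v < k + 2 * k * k" "k + 2 * k * k \<le> w"
      | "k + 2 * k * k \<le> v" using vw(1) by linarith
    then show ?thesis
    proof cases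
      case 1
      then show ?thesis using g(1) vw by (auto simp: f_def strict_mono_on_def)
    next
      case 2
      then show ?thesis using mid(1)[of w] g(2)[of v] by (auto simp: f_def)
    next
      case 3
      then have "k \<le> w - 2 * k * k" "w - 2 * k * k < 2 * k" using vw by linarith+
      then show ?thesis using 3 g(2)[of v] g(3)[of "w - 2 * k * k"] xy by (auto simp: f_def)
    next
      case 4
      let ?v = "(v - k) div (2 * k)" and ?w = "(w - k) div (2 * k)"
      have f: "f v = h ?v ((v - k) mod (2 * k))" "f w = h ?w ((w - k) mod (2 * k))"
        using 4 vw by (auto simp: f_def)
      have "?v \<le> ?w" using vw by (intro div_le_mono) auto
      then consider "?v < ?w" | "?v = ?w" by linarith
      then show ?thesis
      proof cases
        case 1
        then show ?thesis unfolding f using dm[of v] dm[of w] 4 vw by (intro h(4)) auto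
      next
        case 2
        then have "(v - k) mod (2 * k) < (w - k) mod (2 * k)"
          using vw 4 mult_div_mod_eq[of "2 * k" "v - k"] mult_div_mod_eq[of "2 * k" "w - k"]
          by (metis add_less_cancel_left diff_less_mono)
        then show ?thesis unfolding f 2
          using h(1)[of ?w] dm[of v] dm[of w] 4 vw by (auto simp: strict_mono_on_def)
      qed
    next
      case 5
      then have "k \<le> w - 2 * k * k" "w - 2 * k * k < 2 * k" using vw by linarith+
      then show ?thesis using 5 mid(2)[of v] g(3)[of "w - 2 * k * k"] by (auto simp: f_def)
    next
      case 6
      then have "v - 2 * k * k < w - 2 * k * k" "w - 2 * k * k < 2 * k" using vw by linarith+
      then have "g (v - 2 * k * k) < g (w - 2 * k * k)"
        using g(1) by (auto simp: strict_mono_on_def)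
      then show ?thesis using 6 vw by (auto simp: f_def)
    qed
  qed
  then have "strict_mono_on (fst (partial_st_ives k)) f"
    using vertices_st_ives[of k] by (auto simp: strict_mono_on_def subset_iff)
  moreover have "f ` e \<in> R" if "e \<in> snd (partial_st_ives k)" for e
    using that
  proof (cases rule: st_ives_edge_cases)
    case (1 i)
    then have "k + 2 * k * k \<le> 2 * k * k + (2 * k - 1 - i)" by arith
    then have "f ` e = {g i, g (2 * k - 1 - i)}" using 1 by (auto simp: f_def)
    then show ?thesis using g(4)[OF 1(1)] by simp
  next
    case (2 j i)
    have fh: "f (k + 2 * k * j + z) = h j z" if "z < 2 * k" for z
    proof -
      have "2 * k * j + 2 * k \<le> 2 * k * k" using mult_le_mono2[of "Suc j" k "2 * k"] 2(1) by simp
      then have "2 * k * j + z < 2 * k * k" using that by linarith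
      then show ?thesis using that by (simp add: f_def)
    qed
    have "i < 2 * k" "2 * k - 1 - i < 2 * k" using 2(2) by arith+
    then have "f ` e = {h j i, h j (2 * k - 1 - i)}"
      unfolding 2(3) by (simp only: image_insert image_empty fh)
    then show ?thesis using h(3)[OF 2(1,2)] by simp
  qed
  ultimately show ?thesis unfolding contains_copy_def by auto
qed

text \<open>Listing the clique in increasing order embeds any ordered graph with few enough
  vertices. This turns a red clique from Ramsey's theorem into a win.\<close>

lemma clique_copy:
  fixes S :: "rat set" and V :: "nat set"
  assumes "clique S E" "finite S" "V \<subseteq> {..<card S}"
    and "\<And>e. e \<in> F \<Longrightarrow> \<exists>i j. i \<in> V \<and> j \<in> V \<and> i \<noteq> j \<and> e = {i, j}"
  shows "contains_copy (UNIV, E) (V, F)"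
proof -
  let ?f = "\<lambda>i. sorted_list_of_set S ! i"
  have f: "?f i < ?f j" if "i < j" "j < card S" for i j
    using that sorted_wrt_nth_less[OF strict_sorted_list_of_set[of S]] by simp
  have S: "?f i \<in> S" if "i < card S" for i
    using that assms(2) nth_mem[of i "sorted_list_of_set S"] by simp
  have "strict_mono_on V ?f" using f assms(3) by (auto simp: strict_mono_on_def)
  moreover have "?f ` e \<in> E" if e: "e \<in> F" for e
  proof -
    obtain i j where ij: "i < card S" "j < card S" "i \<noteq> j" "e = {i, j}"
      using assms(3,4) e by blast
    then have "?f i \<noteq> ?f j" using f by (metis less_irrefl linorder_neqE_nat)
    then show ?thesis using ij S assms(1) by (auto simp: clique_def)
  qed
  ultimately show ?thesis unfolding contains_copy_def by auto
qed

lemma st_ives_edge_doubleton: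
  assumes "e \<in> snd (partial_st_ives k)"
  shows "\<exists>i j. i \<in> fst (partial_st_ives k) \<and> j \<in> fst (partial_st_ives k) \<and> i \<noteq> j \<and> e = {i, j}"
proof -
  have "e \<subseteq> fst (partial_st_ives k)" using assms by (rule edges_st_ives_subset)
  moreover have "\<exists>i j. i \<noteq> j \<and> e = {i, j}"
    using assms
  proof (cases rule: st_ives_edge_cases)
    case (1 i)
    then have "i \<noteq> 2 * k * k + (2 * k - 1 - i)" by arith
    then show ?thesis using 1 by blast
  next
    case (2 j i)
    then have "k + 2 * k * j + i \<noteq> k + 2 * k * j + (2 * k - 1 - i)" by arith
    then show ?thesis using 2 by blast
  qed
  ultimately show ?thesis by auto
qed

text \<open>
  Paths are listed from their right end, where they are extended. The first \<open>C + 1\<close> vertices of a path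
  need not be joined by edges; they allow a bounded amount of backtracking from the start.
\<close>

fun blue_path :: "nat \<Rightarrow> rat set set \<Rightarrow> rat list \<Rightarrow> bool" where
  "blue_path C B (y # x # zs) \<longleftrightarrow> x < y \<and> (C \<le> length zs \<longrightarrow> {x, y} \<in> B) \<and> blue_path C B (x # zs)"
| "blue_path C B _ \<longleftrightarrow> True"

lemma blue_path_mono: "blue_path C B ys \<Longrightarrow> B \<subseteq> B' \<Longrightarrow> blue_path C B' ys"
  by (induction C B ys rule: blue_path.induct) auto

lemma blue_path_tl: "blue_path C B (y # ys) \<Longrightarrow> blue_path C B ys"
  by (cases ys) auto

lemma blue_path_drop: "blue_path C B ys \<Longrightarrow> blue_path C B (drop i ys)"
proof (induction i arbitrary: ys)
  case (Suc i)
  then show ?case by (cases ys) (auto dest: blue_path_tl)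
qed auto

lemma blue_path_take_0: "blue_path 0 B ys \<Longrightarrow> blue_path 0 B (take i ys)"
proof (induction i arbitrary: ys)
  case (Suc i)
  show ?case
  proof (cases ys)
    case (Cons y ys')
    then show ?thesis using Suc.IH[of ys'] Suc.prems by (cases ys'; cases i) (auto dest: blue_path_tl)
  qed auto
qed auto

lemma blue_path_append:
  assumes "blue_path 0 B qs" "blue_path C B ys" "qs \<noteq> []" "ys \<noteq> []" "hd ys < last qs"
    "{hd ys, last qs} \<in> B"
  shows "blue_path C B (qs @ ys)"
  using assms
proof (induction qs rule: induct_list012)
  case (2 q)
  then show ?case by (cases ys) auto
next
  case (3 q q' qs)
  then show ?case by auto
qed auto

lemma blue_path_sorted: "blue_path C B ys \<Longrightarrow> sorted_wrt (>) ys"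
proof (induction C B ys rule: blue_path.induct)
  case (1 C B y x zs)
  then show ?case by auto
qed auto

lemma blue_path_nth:
  "blue_path C B ys \<Longrightarrow> Suc i + C < length ys \<Longrightarrow> {ys ! Suc i, ys ! i} \<in> B"
proof (induction C B ys arbitrary: i rule: blue_path.induct)
  case (1 C B y x zs)
  then show ?case by (cases i) auto
qed auto

lemma path_copy:
  assumes "blue_path C B ys" "n + C \<le> length ys"
  shows "contains_copy (UNIV, B) (ordered_path n)"
proof -
  \<comment> \<open>The list starts at the right end, so the index is reversed. Of the possibly
    unjoined beginning, these \<open>n\<close> vertices contain at most the last one.\<close>
  let ?f = "\<lambda>i. ys ! (n - 1 - i)"
  have "strict_mono_on {..<n} ?f"
    using sorted_wrt_nth_less[OF blue_path_sorted[OF assms(1)]] assms(2)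
    by (auto simp: strict_mono_on_def)
  moreover have "{?f i, ?f (Suc i)} \<in> B" if "Suc i < n" for i
  proof -
    have "Suc (n - 1 - Suc i) = n - 1 - i" using that by arith
    then show ?thesis using blue_path_nth[OF assms(1), of "n - 1 - Suc i"] that assms(2) by auto
  qed
  ultimately show ?thesis unfolding contains_copy_def ordered_path_def by auto
qed

section \<open>The strategy\<close>

text \<open>The last \<open>r\<close> vertices lie to the right of \<open>a\<close>, so that backtracking stays in the gap \<open>(a, b)\<close>.\<close>

definition ends_in :: "nat \<Rightarrow> rat \<Rightarrow> rat \<Rightarrow> rat list \<Rightarrow> bool" where
  "ends_in r a b ys \<longleftrightarrow> r \<le> length ys \<and> ys \<noteq> [] \<and> (\<forall>i<r. a < ys ! i) \<and> hd ys < b"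

lemma ends_in_le: "ends_in r a b ys \<Longrightarrow> r' \<le> r \<Longrightarrow> ends_in r' a b ys"
  unfolding ends_in_def by simp

lemma ends_in_mono: "ends_in r a b ys \<Longrightarrow> a' \<le> a \<Longrightarrow> b \<le> b' \<Longrightarrow> ends_in r a' b' ys"
  unfolding ends_in_def by (auto intro: le_less_trans)

lemma ends_in_hd: "ends_in r a b ys \<Longrightarrow> 1 \<le> r \<Longrightarrow> a < hd ys \<and> hd ys < b"
  unfolding ends_in_def by (auto simp: hd_conv_nth)

lemma ends_in_Cons:
  assumes "ends_in r a b ys" "hd ys < y" "y < c" "1 \<le> r"
  shows "ends_in r a c (y # ys)"
proof -
  have "a < (y # ys) ! i" if "i < r" for i
    using assms ends_in_hd[OF assms(1,4)] that by (cases i) (auto simp: ends_in_def)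
  then show ?thesis using assms by (simp add: ends_in_def)
qed

lemma ends_in_drop:
  assumes "ends_in (r + s) a b ys" "1 \<le> r" "hd (drop s ys) < c"
  shows "ends_in r a c (drop s ys)"
  using assms by (auto simp: ends_in_def)

lemma sorted_desc_nth_less:
  assumes "sorted_wrt (>) ys" "i < j" "j < length ys"
  shows "ys ! j < ys ! i"
  using sorted_wrt_nth_less[OF assms] by simp

lemma blue_path_complete:
  assumes "sorted_wrt (>) zs" "\<And>u v. u \<in> set zs \<Longrightarrow> v \<in> set zs \<Longrightarrow> u \<noteq> v \<Longrightarrow> {u, v} \<in> B"
  shows "blue_path C B zs"
  using assms by (induction C B zs rule: blue_path.induct) auto

text \<open>\<open>ramsey_bound\<close> yields a red clique large enough for the partial St. Ives
  matching or a blue clique carrying a path on \<open>K + k\<close> vertices. \<open>cost\<close>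
  bounds one jump: \<open>k * k\<close> crossing edges plus the pairs of Ramsey points, crudely
  counted as subsets. \<open>K\<close> is a reserve for \<open>2 * k + 1\<close> stages giving up at
  most \<open>k + 1\<close> vertices each: one initial, \<open>k\<close> outside and
  \<open>k\<close> inside an outer matching.\<close>

locale online_game =
  fixes k n C K ramsey_bound :: nat and cost :: nat
  assumes k: "k \<ge> 1"
    and ramsey: "\<And>(V :: rat set) E. finite V \<Longrightarrow> ramsey_bound \<le> card V \<Longrightarrow>
      \<exists>S\<subseteq>V. card S = 2 * k + 2 * k * k \<and> clique S E \<or> card S = K + k \<and> indep S E"
    and K: "K = (2 * k + 1) * (k + 1) + 1"
    and cost: "cost = k * k + 2 ^ ramsey_bound"
begin

section \<open>Forcing a jump or a nested matching\<close>

abbreviation builder_wins :: "nat \<Rightarrow> rat set set \<Rightarrow> rat set set \<Rightarrow> bool" where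
  "builder_wins \<equiv> forces (partial_st_ives k) (ordered_path n)"

lemma builder_wins_mono: "builder_wins m R B \<Longrightarrow> m \<le> m' \<Longrightarrow> R \<subseteq> R' \<Longrightarrow> B \<subseteq> B' \<Longrightarrow> builder_wins m' R' B'"
  by (rule forces_mono)

text \<open>Builder draws a complete graph on \<open>ramsey_bound\<close> points of
  \<open>(a, b)\<close>. A large red clique wins at once; otherwise there is a blue clique, whose
  decreasing list is a path.\<close>

lemma builder_wins_via_path:
  assumes "a < b"
    and wins: "\<And>R' B' qs. R \<subseteq> R' \<Longrightarrow> B \<subseteq> B' \<Longrightarrow> blue_path 0 B' qs \<Longrightarrow> length qs = K + k \<Longrightarrow>
      (\<forall>q\<in>set qs. a < q \<and> q < b) \<Longrightarrow> builder_wins m R' B'"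
  shows "builder_wins (m + 2 ^ ramsey_bound) R B"
proof -
  obtain V where V: "V \<subseteq> {a<..<b}" "finite V" "card V = ramsey_bound"
    using infinite_arbitrarily_large[of "{a<..<b}" ramsey_bound] infinite_Ioo[OF assms(1)] by auto
  define Q where "Q = {{u, v} | u v. u \<in> V \<and> v \<in> V \<and> u \<noteq> v}"
  have Q: "Q \<subseteq> Pow V" unfolding Q_def by auto
  then have "finite Q" "card Q \<le> 2 ^ ramsey_bound"
    using V finite_subset[OF Q] card_mono[OF _ Q] by (auto simp: card_Pow)
  have "builder_wins (m + card Q) R B"
  proof (rule forces_query[OF \<open>finite Q\<close>])
    show "\<exists>u v. u \<noteq> v \<and> e = {u, v}" if "e \<in> Q" for e using that unfolding Q_def by auto
    fix X assume "X \<subseteq> Q"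
    obtain S where S: "S \<subseteq> V" "card S = 2 * k + 2 * k * k \<and> clique S X \<or> card S = K + k \<and> indep S X"
      using ramsey[OF V(2), of X] V(3) by auto
    have finS: "finite S" using S(1) V(2) finite_subset by blast
    from S(2) show "builder_wins m (R \<union> X) (B \<union> (Q - X))"
    proof
      assume *: "card S = 2 * k + 2 * k * k \<and> clique S X"
      have "contains_copy (UNIV, X) (fst (partial_st_ives k), snd (partial_st_ives k))"
        by (rule clique_copy[of S]) (use * finS vertices_st_ives[of k] st_ives_edge_doubleton in auto)
      then have "contains_copy (UNIV, R \<union> X) (partial_st_ives k)"
        by (auto intro: contains_copy_mono)
      then show ?thesis by (rule forces.red)
    next
      assume *: "card S = K + k \<and> indep S X"
      define qs where "qs = rev (sorted_list_of_set S)"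
      have qs: "sorted_wrt (>) qs" "set qs = S" "length qs = K + k"
        using finS * by (auto simp: qs_def sorted_wrt_rev)
      have edge: "{u, v} \<in> B \<union> (Q - X)" if "u \<in> S" "v \<in> S" "u \<noteq> v" for u v
      proof -
        have "{u, v} \<in> Q" unfolding Q_def using that S(1) by blast
        then show ?thesis using * that by (auto simp: indep_def)
      qed
      have "blue_path 0 (B \<union> (Q - X)) qs"
        by (rule blue_path_complete[OF qs(1)]) (use qs(2) edge in auto)
      then show ?thesis
        by (intro wins[of _ _ qs]) (use qs S(1) V(1) in auto)
    qed
  qed
  then show ?thesis using builder_wins_mono \<open>card Q \<le> _\<close> by simp
qed

text \<open>A blue edge among those tested joins the old path to the prepared one, losing fewer than
  \<open>k\<close> old vertices. If all are red, they contain an \<open>N_k\<close> whose left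
  endpoints are the last \<open>k\<close> path vertices. In \<open>refuse\<close> the bound
  \<open>c\<close> is free, so that the rest of the path can be kept to its left.\<close>

lemma builder_wins_via_jump:
  assumes path: "blue_path C B ys" and len: "k < length ys" and ab: "hd ys \<le> a" "a < b"
    and enter: "\<And>R' B' ys'. R \<subseteq> R' \<Longrightarrow> B \<subseteq> B' \<Longrightarrow> blue_path C B' ys' \<Longrightarrow>
      length ys \<le> length ys' + k \<Longrightarrow> ends_in K a b ys' \<Longrightarrow> builder_wins m R' B'"
    and refuse: "\<And>R' B' y. R \<subseteq> R' \<Longrightarrow> B \<subseteq> B' \<Longrightarrow> a < y \<Longrightarrow>
      (\<And>c. c < ys ! (k - 1) \<Longrightarrow> nest R' k c b (hd ys) y) \<Longrightarrow> builder_wins m R' B'"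
  shows "builder_wins (m + cost) R B"
proof -
  have sorted: "sorted_wrt (>) ys" using path by (rule blue_path_sorted)
  have "builder_wins (m + k * k + 2 ^ ramsey_bound) R B"
  proof (rule builder_wins_via_path[OF ab(2)])
    fix R1 B1 qs
    assume RB: "R \<subseteq> R1" "B \<subseteq> B1" and qs: "blue_path 0 B1 qs" "length qs = K + k"
      "\<forall>q\<in>set qs. a < q \<and> q < b"
    define P where "P = take k ys"
    \<comment> \<open>Lists start at the right end, so \<open>drop K\<close> keeps the
      \<open>k\<close> leftmost vertices.\<close>
    define T where "T = drop K qs"
    define Q where "Q = (\<lambda>(p, q). {p, q}) ` (set P \<times> set T)"
    have lenP: "length P = k" "length T = k" using len qs(2) by (auto simp: P_def T_def)
    have "finite Q" "card Q \<le> k * k"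
    proof -
      have "card Q \<le> card (set P \<times> set T)" unfolding Q_def by (rule card_image_le) simp
      also have "\<dots> \<le> k * k"
        using lenP card_length[of P] card_length[of T] by (auto simp: card_cartesian_product intro: mult_le_mono)
      finally show "card Q \<le> k * k" .
    qed (auto simp: Q_def)
    have hd_ge: "y \<le> hd ys" if "y \<in> set ys" for y
      using sorted that by (cases ys) auto
    have PT: "p < q" if "p \<in> set P" "q \<in> set qs" for p q
      using hd_ge[of p] that ab qs(3) in_set_takeD[of p k ys] by (force simp: P_def)
    have T: "set T \<subseteq> set qs" unfolding T_def by (rule set_drop_subset)
    have "builder_wins (m + card Q) R1 B1"
    proof (rule forces_query[OF \<open>finite Q\<close>])
      show "\<exists>u v. u \<noteq> v \<and> e = {u, v}" if "e \<in> Q" for e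
      proof -
        obtain p q where pq: "p \<in> set P" "q \<in> set T" "e = {p, q}"
          using \<open>e \<in> Q\<close> by (auto simp: Q_def)
        then have "p < q" using PT T by blast
        then show ?thesis using pq(3) by (metis less_irrefl)
      qed
      fix X assume "X \<subseteq> Q"
      show "builder_wins m (R1 \<union> X) (B1 \<union> (Q - X))"
      proof (cases "X = Q")
        case True
        have red: "{p, q} \<in> R1 \<union> X" if "p \<in> set P" "q \<in> set T" for p q
          using that True unfolding Q_def by auto
        have hdP: "hd P = hd ys" "P \<noteq> []" "T \<noteq> []" using k lenP by (auto simp: P_def)
        have "nest (R1 \<union> X) k c b (hd ys) (last T)" if c: "c < ys ! (k - 1)" for c
          unfolding hdP(1)[symmetric]
        proof (rule nest_complete_bipartite[OF lenP k])
          show "sorted_wrt (>) P" unfolding P_def using sorted by (rule sorted_wrt_take)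
          show "sorted_wrt (>) T" unfolding T_def using blue_path_sorted[OF qs(1)] by (rule sorted_wrt_drop)
          show "c < p" if p: "p \<in> set P" for p
          proof -
            obtain i where i: "i < k" "p = ys ! i" using p lenP by (auto simp: P_def in_set_conv_nth)
            consider "i = k - 1" | "i < k - 1" using i(1) by linarith
            then show ?thesis
            proof cases
              case 2
              then have "ys ! (k - 1) < ys ! i" using len by (intro sorted_desc_nth_less[OF sorted]) auto
              then show ?thesis using c i(2) by simp
            qed (use c i in simp)
          qed
          show "q < b" if "q \<in> set T" for q using that T qs(3) by auto
          show "hd P < last T" using PT hdP T by (meson hd_in_set last_in_set subsetD)
        qed (use red in auto)
        moreover have "a < last T" using hdP(3) T qs(3) last_in_set by blast
        ultimately show ?thesis by (intro refuse[of _ _ "last T"]) (use RB in auto)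
      next
        case False
        then obtain e where "e \<in> Q - X" using \<open>X \<subseteq> Q\<close> by blast
        moreover from this obtain p q where "p \<in> set P" "q \<in> set T" "e = {p, q}" by (auto simp: Q_def)
        ultimately have pq: "p \<in> set P" "q \<in> set T" "{p, q} \<in> Q - X" by auto
        obtain i where i: "i < k" "p = ys ! i" using pq(1) lenP by (auto simp: P_def in_set_conv_nth)
        obtain j where j: "j < k" "q = qs ! (K + j)" using pq(2) lenP qs(2)
          by (auto simp: T_def in_set_conv_nth)
        \<comment> \<open>\<open>us\<close> runs from the right end of \<open>qs\<close> down to
          \<open>q\<close>. It has at least \<open>K + 1\<close> vertices, all in
          \<open>(a, b)\<close>, so the reserve is full again.\<close>
        define us where "us = take (Suc (K + j)) qs"
        define ys' where "ys' = us @ drop i ys"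
        have us: "us \<noteq> []" "last us = q" "set us \<subseteq> set qs" "length us = Suc (K + j)"
          using j qs(2) by (auto simp: us_def take_Suc_conv_app_nth set_take_subset)
        have hdd: "hd (drop i ys) = p" using i len by (simp add: hd_drop_conv_nth)
        have "blue_path C (B1 \<union> (Q - X)) ys'" unfolding ys'_def
        proof (rule blue_path_append)
          show "blue_path 0 (B1 \<union> (Q - X)) us" unfolding us_def
            by (intro blue_path_take_0 blue_path_mono[OF qs(1)]) auto
          show "blue_path C (B1 \<union> (Q - X)) (drop i ys)"
            by (intro blue_path_drop blue_path_mono[OF path]) (use RB in auto)
        qed (use us hdd pq PT T i len in auto)
        moreover have "ends_in K a b ys'"
        proof -
          have "a < ys' ! i" if "i < K" for i
          proof -
            have "i < length us" using that us(4) by simp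
            then have "us ! i \<in> set qs" using us(3) nth_mem by blast
            then show ?thesis using qs(3) \<open>i < length us\<close> by (simp add: ys'_def nth_append)
          qed
          moreover have "hd ys' \<in> set qs" using us by (auto simp: ys'_def)
          ultimately show ?thesis using us qs(3) by (auto simp: ends_in_def ys'_def)
        qed
        ultimately show ?thesis
          by (intro enter[of _ _ ys']) (use RB i len us(4) in \<open>auto simp: ys'_def\<close>)
      qed
    qed
    then show "builder_wins (m + k * k) R1 B1" by (rule builder_wins_mono) (use \<open>card Q \<le> _\<close> in auto)
  qed
  then show ?thesis by (simp add: cost add.assoc)
qed

text \<open>One nesting stage. A red answer to \<open>{p0, q}\<close> gives up \<open>p0\<close> and
  supplies the next inner edge; a jump from the rest of the path into \<open>(p0, q)\<close> then
  gains a level or leaves a red \<open>N_k\<close> to the right of the shortened path. The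
  continuations refer to \<open>R0\<close> and \<open>B0\<close> because the position grows during
  the induction. \<open>n + C - length ys\<close> counts the path vertices still missing.\<close>

lemma builder_wins_via_nest:
  assumes "r \<ge> 1" "r + k + 1 \<le> K"
    and right: "\<And>R' B' ys' c x y. R0 \<subseteq> R' \<Longrightarrow> B0 \<subseteq> B' \<Longrightarrow> blue_path C B' ys' \<Longrightarrow> ends_in r a c ys' \<Longrightarrow>
      nest R' k c b x y \<Longrightarrow> builder_wins (n + C - length ys' + w) R' B'"
    and inside: "\<And>R' B' ys' x y. R0 \<subseteq> R' \<Longrightarrow> B0 \<subseteq> B' \<Longrightarrow> blue_path C B' ys' \<Longrightarrow>
      ends_in (r + k + 1) x y ys' \<Longrightarrow> nest R' k a b x y \<Longrightarrow> builder_wins (n + C - length ys' + w) R' B'"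
    and "R0 \<subseteq> R" "B0 \<subseteq> B" "blue_path C B ys" "ends_in (r + k + 1) x y ys" "nest R d a b x y" "d \<le> k"
  shows "builder_wins (n + C - length ys + w + (k - d) * (cost + k + 2)) R B"
  using assms(5-)
\<comment> \<open>The turn budget itself is the measure: a blue answer lowers the number of missing
  vertices, and a successful jump trades at most \<open>k + 1\<close> lost vertices for a level
  worth \<open>cost + k + 2\<close>.\<close>
proof (induction "n + C - length ys + w + (k - d) * (cost + k + 2)" arbitrary: R B ys d x y
    rule: less_induct)
  case less
  note IH = less.hyps and RB = less.prems(1,2) and path = less.prems(3) and win = less.prems(4)
    and nest = less.prems(5)
  let ?w = "w + (k - d) * (cost + k + 2)"
  consider "n + C \<le> length ys" | "length ys < n + C" "d = k" | "length ys < n + C" "d < k"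
    using less.prems(6) by linarith
  then show ?case
  proof cases
    case 1
    then show ?thesis using path_copy[OF path] by (intro forces.blue) simp
  next
    case 2
    then show ?thesis using inside[OF RB path win] nest by simp
  next
    case 3
    obtain p0 ys1 where ys: "ys = p0 # ys1" using win by (cases ys) (auto simp: ends_in_def)
    have p0: "x < p0" "p0 < y" using ends_in_hd[OF win] by (auto simp: ys)
    obtain q where q: "p0 < q" "q < y" using dense[OF p0(2)] by auto
    have sorted: "sorted_wrt (>) ys" using path by (rule blue_path_sorted)
    have len: "r + k \<le> length ys1" using win by (auto simp: ys ends_in_def)
    \<comment> \<open>The budget left after the query and the jump, with \<open>k + 1\<close> turns
      for replacing \<open>p0\<close> and up to \<open>k\<close> further lost vertices.\<close>
    define m where "m = n + C - length ys + k + 1 + w + (k - Suc d) * (cost + k + 2)"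
    have kd: "k - d = Suc (k - Suc d)" using 3 by simp
    have total: "n + C - length ys + ?w = Suc (m + cost)" by (simp add: m_def kd)
    have "builder_wins (n + C - length (q # ys) + w + (k - d) * (cost + k + 2)) R (insert {p0, q} B)"
    proof (rule IH)
      show "blue_path C (insert {p0, q} B) (q # ys)"
        using blue_path_mono[OF path, of "insert {p0, q} B"] q by (auto simp: ys)
      show "ends_in (r + k + 1) x y (q # ys)" by (rule ends_in_Cons[OF win]) (use q in \<open>auto simp: ys\<close>)
    qed (use 3 RB nest in auto)
    then have blue: "builder_wins (m + cost) R (insert {p0, q} B)"
      by (rule builder_wins_mono) (use 3 total in auto)
    have red: "builder_wins (m + cost) (insert {p0, q} R) B"
    proof (rule builder_wins_via_jump[of B ys1 p0 q])
      show "blue_path C B ys1" using path blue_path_tl by (simp add: ys)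
      show "k < length ys1" using len assms(1) by simp
      then show "hd ys1 \<le> p0" using sorted by (cases ys1) (auto simp: ys)
      show "p0 < q" by fact
    next
      fix R' B' ys'
      assume *: "insert {p0, q} R \<subseteq> R'" "B \<subseteq> B'" "blue_path C B' ys'" "length ys1 \<le> length ys' + k"
        "ends_in K p0 q ys'"
      have "nest R' (Suc d) a b p0 q"
        by (rule nest_Suc[OF nest_mono[OF nest]]) (use * p0 q in auto)
      moreover have "ends_in (r + k + 1) p0 q ys'" using ends_in_le[OF *(5)] assms(2) by simp
      moreover have "n + C - length ys' \<le> n + C - length ys + k + 1" using *(4) by (simp add: ys)
      ultimately have "builder_wins (n + C - length ys' + w + (k - Suc d) * (cost + k + 2)) R' B'"
        using * RB 3 by (intro IH) (auto simp: kd)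
      then show "builder_wins m R' B'"
        by (rule builder_wins_mono) (use *(4) in \<open>auto simp: m_def ys\<close>)
    next
      fix R' B' y'
      assume *: "insert {p0, q} R \<subseteq> R'" "B \<subseteq> B'" "p0 < y'"
        "\<And>c. c < ys1 ! (k - 1) \<Longrightarrow> nest R' k c q (hd ys1) y'"
      have "ys1 ! k < ys1 ! (k - 1)"
        using sorted_desc_nth_less[of ys1 "k - 1" k] sorted len assms(1) k by (auto simp: ys)
      \<comment> \<open>The cut \<open>c\<close> separates the left endpoints of the new copy from
        the remaining path.\<close>
      then obtain c where c: "ys1 ! k < c" "c < ys1 ! (k - 1)" using dense by blast
      have "nest R' k c b (hd ys1) y'"
        using *(4)[OF c(2)] by (rule nest_mono) (use q nest in \<open>auto simp: nest_def\<close>)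
      moreover have "ends_in r a c (drop (k + 1) ys)"
      proof (rule ends_in_drop)
        show "ends_in (r + (k + 1)) a y ys"
          using ends_in_mono[OF win, of a y] nest by (auto simp: nest_def)
        show "hd (drop (k + 1) ys) < c" using c len assms(1) by (simp add: ys hd_drop_conv_nth)
      qed fact
      ultimately have "builder_wins (n + C - length (drop (k + 1) ys) + w) R' B'"
        by (intro right[OF _ _ blue_path_drop[OF blue_path_mono[OF path]]]) (use * RB in auto)
      then show "builder_wins m R' B'"
        by (rule builder_wins_mono) (use len in \<open>auto simp: m_def ys\<close>)
    qed
    show ?thesis unfolding total[symmetric] add.assoc[symmetric]
      using forces.step[OF _ red blue] q total by (simp add: add.assoc)
  qed
qed

section \<open>Collecting copies inside and outside an outer matching\<close>

abbreviation round_cost :: nat where "round_cost \<equiv> (k + 1) * (cost + k + 2)"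

text \<open>Induction on the number \<open>t\<close> of copies still to be collected. The path's end
  is in the free interval \<open>(u, v)\<close>, with \<open>i\<close> copies to its left and
  \<open>j\<close> to its right. A stage adds a copy on the right or traps the end in a new copy,
  which joins the left chain if the path escapes. The reserve allows \<open>k + 1\<close> lost
  vertices per stage.\<close>

lemma builder_wins_enclosed:
  assumes "blue_path C B ys" "nest R k a b x y" "chain R k i x u" "chain R k j v y"
    "ends_in (t * (k + 1) + 1) u v ys" "k \<le> i + j + t" "t \<le> k"
  shows "builder_wins (n + C - length ys + t * round_cost) R B"
  using assms
proof (induction t arbitrary: R B ys i j u v)
  case 0
  have "u < v" using ends_in_hd[OF 0(5)] by simp
  then have "chain R k i x v" by (intro chain_mono[OF 0(3)]) auto
  then have "chain R k (i + j) x y" using 0(4) by (rule chain_append)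
  then have "contains_copy (UNIV, R) (partial_st_ives k)"
    using st_ives_copy[OF 0(2)] 0(6) by simp
  then show ?case by (rule forces.red)
next
  case (Suc t)
  let ?r = "t * (k + 1) + 1" and ?w = "t * round_cost + k + cost"
  have uv: "u < v" using ends_in_hd[OF Suc.prems(5)] by simp
  have tK: "t * (k + 1) \<le> k * (k + 1)" using Suc.prems(7) by (intro mult_le_mono1) simp
  have "builder_wins (n + C - length ys + ?w + (k - 0) * (cost + k + 2)) R B"
  proof (rule builder_wins_via_nest[where r = ?r and a = u and b = v and x = u and y = v and ?R0.0 = R and ?B0.0 = B])
    show "?r + k + 1 \<le> K" using tK by (simp add: K)
    have "?r + k + 1 = Suc t * (k + 1) + 1" by simp
    then show "ends_in (?r + k + 1) u v ys" using Suc.prems(5) by (simp only:)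
    show "nest R 0 u v u v" using uv by (simp add: nest_0)
  next
    fix R' B' ys' c x' y'
    assume *: "R \<subseteq> R'" "B \<subseteq> B'" "blue_path C B' ys'" "ends_in ?r u c ys'" "nest R' k c v x' y'"
    have "chain R' k j v y" by (rule chain_mono[OF Suc.prems(4) *(1)]) auto
    then have "chain R' k (Suc j) c y" using *(5) by auto
    moreover have "nest R' k a b x y" by (rule nest_mono[OF Suc.prems(2) *(1)]) auto
    moreover have "chain R' k i x u" by (rule chain_mono[OF Suc.prems(3) *(1)]) auto
    ultimately have "builder_wins (n + C - length ys' + t * round_cost) R' B'"
      using Suc.prems(6,7) *(3,4) by (intro Suc.IH[where i = i and j = "Suc j" and u = u and v = c]) auto
    then show "builder_wins (n + C - length ys' + ?w) R' B'" by (rule builder_wins_mono) auto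
  next
    fix R' B' ys' x' y'
    assume *: "R \<subseteq> R'" "B \<subseteq> B'" "blue_path C B' ys'" "ends_in (?r + k + 1) x' y' ys'" "nest R' k u v x' y'"
    from nest_shrink[OF *(5) k] obtain v' where v': "v' < v" "nest R' k u v' x' y'" by blast
    have nest': "nest R' k a b x y" by (rule nest_mono[OF Suc.prems(2) *(1)]) auto
    have chains: "chain R' k i x u" "chain R' k j v y"
      by (rule chain_mono[OF Suc.prems(3) *(1)] chain_mono[OF Suc.prems(4) *(1)]; simp)+
    have left: "chain R' k (Suc i) x v'"
    proof -
      have "chain R' k 1 u v'" using v'(2) by auto
      then show ?thesis using chain_append[OF chains(1), of 1 v'] by simp
    qed
    have hd: "hd ys' < v'" using ends_in_hd[OF *(4)] v'(2) by (auto simp: nest_def)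
    have len: "k < length ys'" using *(4) by (auto simp: ends_in_def)
    have sorted: "sorted_wrt (>) ys'" using *(3) by (rule blue_path_sorted)
    have "builder_wins (n + C - length ys' + k + t * round_cost + cost) R' B'"
    proof (rule builder_wins_via_jump[of B' ys' v' v])
      fix R'' B'' zs
      assume **: "R' \<subseteq> R''" "B' \<subseteq> B''" "blue_path C B'' zs" "length ys' \<le> length zs + k" "ends_in K v' v zs"
      have "ends_in ?r v' v zs" by (rule ends_in_le[OF **(5)]) (use tK in \<open>simp add: K\<close>)
      moreover have "nest R'' k a b x y" by (rule nest_mono[OF nest' **(1)]) auto
      moreover have "chain R'' k (Suc i) x v'" by (rule chain_mono[OF left **(1)]) auto
      moreover have "chain R'' k j v y" by (rule chain_mono[OF chains(2) **(1)]) auto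
      ultimately have "builder_wins (n + C - length zs + t * round_cost) R'' B''"
        using Suc.prems(6,7) **(3) by (intro Suc.IH[where i = "Suc i" and j = j and u = v' and v = v]) auto
      then show "builder_wins (n + C - length ys' + k + t * round_cost) R'' B''"
        by (rule builder_wins_mono) (use **(4) in auto)
    next
      fix R'' B'' q
      assume **: "R' \<subseteq> R''" "B' \<subseteq> B''" "v' < q"
        "\<And>c. c < ys' ! (k - 1) \<Longrightarrow> nest R'' k c v (hd ys') q"
      have "ys' ! k < ys' ! (k - 1)" using sorted_desc_nth_less[OF sorted, of "k - 1" k] len k by auto
      \<comment> \<open>On refusal the red copy just formed is counted instead of the trapping one,
        which it may overlap: it joins the right chain, and the left bound stays
        \<open>u\<close>.\<close>
      then obtain c where c: "ys' ! k < c" "c < ys' ! (k - 1)" using dense by blast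
      have "chain R'' k j v y" by (rule chain_mono[OF chains(2) **(1)]) auto
      then have "chain R'' k (Suc j) c y" using **(4)[OF c(2)] by auto
      moreover have "nest R'' k a b x y" by (rule nest_mono[OF nest' **(1)]) auto
      moreover have "chain R'' k i x u" by (rule chain_mono[OF chains(1) **(1)]) auto
      moreover have "ends_in ?r u c (drop k ys')"
      proof (rule ends_in_drop)
        have "ends_in (?r + k) x' y' ys'" by (rule ends_in_le[OF *(4)]) simp
        then show "ends_in (?r + k) u y' ys'" by (rule ends_in_mono) (use *(5) in \<open>auto simp: nest_def\<close>)
        show "hd (drop k ys') < c" using c len by (simp add: hd_drop_conv_nth)
      qed simp
      moreover have "blue_path C B'' (drop k ys')"
        by (intro blue_path_drop blue_path_mono[OF *(3)]) (use ** in auto)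
      ultimately have "builder_wins (n + C - length (drop k ys') + t * round_cost) R'' B''"
        using Suc.prems(6,7) by (intro Suc.IH[where i = i and j = "Suc j" and u = u and v = c]) auto
      then show "builder_wins (n + C - length ys' + k + t * round_cost) R'' B''"
        by (rule builder_wins_mono) (use len in auto)
    qed (use * hd v' len in auto)
    then show "builder_wins (n + C - length ys' + ?w) R' B'" by (simp add: ac_simps)
  qed (use Suc.prems(1) in auto)
  \<comment> \<open>\<open>round_cost\<close> covers \<open>k\<close> levels at
    \<open>cost + k + 2\<close> each and one escape jump with its lost vertices.\<close>
  then show ?case by (rule builder_wins_mono) (auto simp: algebra_simps)
qed

text \<open>Copies gather between the path and an outer matching to its right. Once there are
  \<open>k\<close>, refusing the jump into the innermost gap loses for Painter: the resulting red
  \<open>N_k\<close> has its left endpoints below \<open>v\<close> and its right ones above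
  \<open>e\<close>, and so encloses the chain. If the jump succeeds,
  \<open>builder_wins_enclosed\<close> takes over with \<open>k\<close> copies to collect, hence the
  factor \<open>k + 1 + t\<close>.\<close>

lemma builder_wins_outside:
  assumes "blue_path C B ys" "nest R k e b x y" "chain R k j v e"
    "ends_in ((k + t) * (k + 1) + 1) u v ys" "k \<le> j + t" "t \<le> k"
  shows "builder_wins (n + C - length ys + (k + 1 + t) * round_cost) R B"
  using assms
proof (induction t arbitrary: R B ys j v)
  case 0
  have ve: "v \<le> e" using 0(3) by (rule chain_less_eq)
  have hd: "hd ys < v" using ends_in_hd[OF 0(4)] by simp
  have "builder_wins (n + C - length ys + k + k * round_cost + cost) R B"
  proof (rule builder_wins_via_jump[of B ys x y])
    show "blue_path C B ys" by fact
    show "k < length ys" using 0(4) by (auto simp: ends_in_def)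
    show "hd ys \<le> x" "x < y" using 0(2) ve hd by (auto simp: nest_def)
  next
    fix R' B' ys'
    assume *: "R \<subseteq> R'" "B \<subseteq> B'" "blue_path C B' ys'" "length ys \<le> length ys' + k" "ends_in K x y ys'"
    have "ends_in (k * (k + 1) + 1) x y ys'" by (rule ends_in_le[OF *(5)]) (simp add: K)
    then have "builder_wins (n + C - length ys' + k * round_cost) R' B'"
      using nest_mono[OF 0(2) *(1) order.refl order.refl] *(3)
      by (intro builder_wins_enclosed[where i = 0 and j = 0 and u = x and v = y]) auto
    then show "builder_wins (n + C - length ys + k + k * round_cost) R' B'"
      by (rule builder_wins_mono) (use *(4) in auto)
  next
    fix R' B' q
    assume *: "R \<subseteq> R'" "B \<subseteq> B'" "x < q" "\<And>c. c < ys ! (k - 1) \<Longrightarrow> nest R' k c y (hd ys) q"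
    \<comment> \<open>The left bound is an arbitrary number below
      \<open>ys ! (k - 1)\<close>.\<close>
    have "nest R' k (ys ! (k - 1) - 1) y (hd ys) q" by (rule *(4)) simp
    moreover have "chain R' k j v e" using chain_mono[OF 0(3) *(1)] by simp
    moreover have "e \<le> q" using 0(2) *(3) by (auto simp: nest_def)
    ultimately have "contains_copy (UNIV, R') (partial_st_ives k)"
      using hd 0(5) by (intro st_ives_copy[where c = v and d = e]) auto
    then show "builder_wins (n + C - length ys + k + k * round_cost) R' B'" by (rule forces.red)
  qed
  then show ?case by (rule builder_wins_mono) (auto simp: algebra_simps)
next
  case (Suc t)
  let ?r = "(k + t) * (k + 1) + 1"
  have uv: "u < v" using ends_in_hd[OF Suc.prems(4)] by simp
  have tK: "(k + Suc t) * (k + 1) \<le> (k + k) * (k + 1)" using Suc.prems(6) by (intro mult_le_mono1) simp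
  have "builder_wins (n + C - length ys + (k + 1 + t) * round_cost + (k - 0) * (cost + k + 2)) R B"
  proof (rule builder_wins_via_nest[where r = ?r and a = u and b = v and x = u and y = v and ?R0.0 = R and ?B0.0 = B])
    show "?r + k + 1 \<le> K" using tK by (simp add: K algebra_simps)
    have "?r + k + 1 = (k + Suc t) * (k + 1) + 1" by simp
    then show "ends_in (?r + k + 1) u v ys" using Suc.prems(4) by (simp only:)
    show "nest R 0 u v u v" using uv by (simp add: nest_0)
  next
    fix R' B' ys' c x' y'
    assume *: "R \<subseteq> R'" "B \<subseteq> B'" "blue_path C B' ys'" "ends_in ?r u c ys'" "nest R' k c v x' y'"
    have "chain R' k j v e" by (rule chain_mono[OF Suc.prems(3) *(1)]) auto
    then have "chain R' k (Suc j) c e" using *(5) by auto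
    moreover have "nest R' k e b x y" by (rule nest_mono[OF Suc.prems(2) *(1)]) auto
    ultimately show "builder_wins (n + C - length ys' + (k + 1 + t) * round_cost) R' B'"
      using Suc.prems(5,6) *(3,4) by (intro Suc.IH[where j = "Suc j" and v = c]) auto
  next
    fix R' B' ys' x' y'
    assume *: "R \<subseteq> R'" "B \<subseteq> B'" "blue_path C B' ys'" "ends_in (?r + k + 1) x' y' ys'" "nest R' k u v x' y'"
    \<comment> \<open>The copy that traps the path becomes the outer matching, and counting restarts
      with no inner copies.\<close>
    have "ends_in (k * (k + 1) + 1) x' y' ys'" by (rule ends_in_le[OF *(4)]) (simp add: algebra_simps)
    then have "builder_wins (n + C - length ys' + k * round_cost) R' B'"
      using * nest_less[OF *(5)] by (intro builder_wins_enclosed[where i = 0 and j = 0 and u = x' and v = y']) auto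
    then show "builder_wins (n + C - length ys' + (k + 1 + t) * round_cost) R' B'"
      by (rule builder_wins_mono[OF _ add_left_mono[OF mult_le_mono1]]) auto
  qed (use Suc.prems(1) in auto)
  then show ?case by (rule builder_wins_mono) (auto simp: algebra_simps)
qed

text \<open>The first stage starts from a plain gap and produces an \<open>N_k\<close> to the right
  of the path or around its end. The bound adds this stage to the \<open>2 * k + 1\<close> rounds of
  the costlier case, \<open>builder_wins_outside\<close>.\<close>

lemma builder_wins_from_path:
  assumes "blue_path C B ys" "ends_in K a b ys"
  shows "builder_wins (n + C - length ys + (2 * k + 2) * round_cost) R B"
proof -
  let ?r = "(k + k) * (k + 1) + 1"
  have ab: "a < b" using ends_in_hd[OF assms(2)] by (simp add: K)
  have "builder_wins (n + C - length ys + (k + 1 + k) * round_cost + (k - 0) * (cost + k + 2)) R B"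
  proof (rule builder_wins_via_nest[where r = ?r and a = a and b = b and x = a and y = b and ?R0.0 = R and ?B0.0 = B])
    show "?r + k + 1 \<le> K" by (simp add: K algebra_simps)
    show "ends_in (?r + k + 1) a b ys" by (rule ends_in_le[OF assms(2)]) (simp add: K algebra_simps)
    show "nest R 0 a b a b" using ab by (simp add: nest_0)
  next
    fix R' B' ys' c x y
    assume *: "R \<subseteq> R'" "B \<subseteq> B'" "blue_path C B' ys'" "ends_in ?r a c ys'" "nest R' k c b x y"
    then show "builder_wins (n + C - length ys' + (k + 1 + k) * round_cost) R' B'"
      \<comment> \<open>With \<open>e = v = c\<close> the chain between path and outer matching
        starts empty.\<close>
      by (intro builder_wins_outside[where e = c and v = c and j = 0 and u = a]) auto
  next
    fix R' B' ys' x y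
    assume *: "R \<subseteq> R'" "B \<subseteq> B'" "blue_path C B' ys'" "ends_in (?r + k + 1) x y ys'" "nest R' k a b x y"
    have "ends_in (k * (k + 1) + 1) x y ys'" by (rule ends_in_le[OF *(4)]) (simp add: algebra_simps)
    then have "builder_wins (n + C - length ys' + k * round_cost) R' B'"
      using * nest_less[OF *(5)] by (intro builder_wins_enclosed[where i = 0 and j = 0 and u = x and v = y]) auto
    then show "builder_wins (n + C - length ys' + (k + 1 + k) * round_cost) R' B'"
      by (rule builder_wins_mono[OF _ add_left_mono[OF mult_le_mono1]]) auto
  qed (use assms(1) in auto)
  then show ?thesis by (rule builder_wins_mono) (auto simp: algebra_simps)
qed

text \<open>The first \<open>C + 1\<close> vertices need no edges, so for \<open>C = K\<close> a
  list of \<open>K\<close> isolated vertices is already a path with full reserve, and exactly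
  \<open>n\<close> vertices are missing.\<close>

lemma builder_wins_initially:
  assumes "C = K"
  shows "builder_wins (n + (2 * k + 2) * round_cost) {} {}"
proof -
  define ys where "ys = map rat_of_nat (rev [0..<K])"
  have "blue_path C {} zs" if "sorted_wrt (>) zs" "length zs \<le> K" for zs
    using that assms by (induction C "{} :: rat set set" zs rule: blue_path.induct) auto
  moreover have "sorted_wrt (>) ys" by (simp add: ys_def sorted_wrt_map sorted_wrt_rev)
  moreover have len: "length ys = K" by (simp add: ys_def)
  ultimately have "blue_path C {} ys" by simp
  moreover have "ends_in K (-1) (rat_of_nat K) ys"
  proof -
    have nth: "ys ! i = rat_of_nat (K - Suc i)" if "i < K" for i
      using that by (simp add: ys_def rev_nth)
    have "0 < K" using K by simp
    then have "ys \<noteq> []" "hd ys < rat_of_nat K"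
      using len nth[of 0] by (auto simp: hd_conv_nth simp flip: length_greater_0_conv)
    moreover have "- 1 < ys ! i" if "i < K" for i
      unfolding nth[OF that] by (rule less_le_trans[of _ 0]) auto
    ultimately show ?thesis using len by (simp add: ends_in_def)
  qed
  ultimately show ?thesis using builder_wins_from_path[of "{}" ys] len assms by fastforce
qed

end

theorem theorem1p7:
  fixes k :: nat
  assumes "k \<ge> 1"
  shows "\<exists>c::nat. \<forall>n::nat. n \<ge> 1 \<longrightarrow>
           online_ordered_ramsey (partial_st_ives k) (ordered_path n) \<le> enat (n + c)"
proof -
  define K where "K = (2 * k + 1) * (k + 1) + 1"
  \<comment> \<open>\<open>N\<close> depends on \<open>k\<close> only, which makes the final
    constant independent of \<open>n\<close>.\<close>
  obtain N where N: "\<forall>(V :: rat set) E. finite V \<and> N \<le> card V \<longrightarrow>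
      (\<exists>S\<subseteq>V. card S = 2 * k + 2 * k * k \<and> clique S E \<or> card S = K + k \<and> indep S E)"
    using ramsey2[of "2 * k + 2 * k * k" "K + k"] by metis
  define cost where "cost = k * k + 2 ^ N"
  have "online_ordered_ramsey (partial_st_ives k) (ordered_path n) \<le>
      enat (n + (2 * k + 2) * ((k + 1) * (cost + k + 2)))" for n
  proof -
    \<comment> \<open>The third argument instantiates \<open>C\<close> by \<open>K\<close>, as
      \<open>builder_wins_initially\<close> demands.\<close>
    interpret online_game k n K K N cost
      by standard (use assms N in \<open>auto simp: K_def cost_def\<close>)
    show ?thesis
    proof (rule online_ordered_ramsey_le_forces[OF builder_wins_initially])
      show "finite (fst (ordered_path n))" by (simp add: ordered_path_def)
      show "e \<subseteq> fst (ordered_path n)" if "e \<in> snd (ordered_path n)" for e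
        using that by (auto simp: ordered_path_def)
    qed (use finite_vertices_st_ives edges_st_ives_subset in auto)
  qed
  then show ?thesis by blast
qed

end
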